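(* Let $\alpha\in\mathbb{R}$ and let $F$ be the Freund $4$-manifold with coordinates $(x_1,x_2,x_3,x_4)=(\alpha_1,\beta_1,\alpha_2,\beta_2)\in(0,\infty)^4$. The components $R^{(\alpha)}_{ijkl}$ of its $\alpha$-curvature tensor are given by $$R^{(\alpha)}_{1212}=\frac{(\alpha^2-1)\,\alpha_2^2}{4\,\alpha_1(\alpha_1+\alpha_2)^3\beta_1^2},\qquad R^{(\alpha)}_{1223}=\frac{(\alpha^2-1)\,\alpha_2}{4(\alpha_1+\alpha_2)^3\beta_1^2},$$ $$R^{(\alpha)}_{1414}=\frac{(\alpha^2-1)\,\alpha_2}{4(\alpha_1+\alpha_2)^3\beta_2^2},\qquad R^{(\alpha)}_{1434}=\frac{-(\alpha^2-1)\,\alpha_1}{4(\alpha_1+\alpha_2)^3\beta_2^2},$$ $$R^{(\alpha)}_{2323}=\frac{(\alpha^2-1)\,\alpha_1}{4(\alpha_1+\alpha_2)^3\beta_1^2},\qquad R^{(\alpha)}_{2424}=\frac{(\alpha^2-1)\,\alpha_1\alpha_2}{4(\alpha_1+\alpha_2)^2\beta_1^2\beta_2^2},$$ $$R^{(\alpha)}_{3434}=\frac{(\alpha^2-1)\,\alpha_1^2}{4\,\alpha_2(\alpha_1+\alpha_2)^3\beta_2^2},$$ while the other independent components are zero (that is, every component not obtained from the listed ones by the symmetries $R_{ijkl}=-R_{jikl}=-R_{ijlk}=R_{klij}$ vanishes).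
   Context: The Freund $4$-manifold $F$ is the family of densities on $(0,\infty)^2$ $$f(x,y;\alpha_1,\beta_1,\alpha_2,\beta_2)=\begin{cases}\alpha_1\beta_2\,e^{-\beta_2 y-(\alpha_1+\alpha_2-\beta_2)x} & 0< x<y,\\ \alpha_2\beta_1\,e^{-\beta_1 x-(\alpha_1+\alpha_2-\beta_1)y} & 0<y\le x,\end{cases}\qquad \alpha_i,\beta_i>0,$$ with coordinates $(x_1,x_2,x_3,x_4)=(\alpha_1,\beta_1,\alpha_2,\beta_2)$ and the Fisher information metric $g_{ij}=-\int_0^\infty\int_0^\infty \frac{\partial^2\log f}{\partial x_i\partial x_j}f\,dx\,dy$. The subscripted $\alpha_1,\alpha_2$ are coordinates, unrelated to the real number $\alpha$. With $\partial_i=\partial/\partial x_i$, the $\alpha$-connection $\nabla^{(\alpha)}$ is the torsion-free affine connection with $g(\nabla^{(\alpha)}_{\partial_i}\partial_j,\partial_k)=\Gamma^{(\alpha)}_{ij,k}$, where $$\Gamma^{(\alpha)}_{ij,k}=\int_0^\infty\!\!\int_0^\infty\Big(\partial_i\partial_j\log f\;\partial_k\log f+\tfrac{1-\alpha}{2}\,\partial_i\log f\,\partial_j\log f\,\partial_k\log f\Big)f\,dx\,dy.$$ The $\alpha$-curvature tensor is the curvature of $\nabla^{(\alpha)}$, $R(X,Y)Z=\nabla_X\nabla_YZ-\nabla_Y\nabla_XZ-\nabla_{[X,Y]}Z$, with components $R^{(\alpha)}_{ijkl}=g(R(\partial_i,\partial_j)\partial_k,\partial_l)$. *)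

theory Defs
  imports "HOL-Analysis.Analysis"
begin

section \<open>Vector fields and affine connections in a global chart\<close>

text \<open>
  Vector fields on an open subset of \<^typ>\<open>real^'n\<close> are total functions \<^typ>\<open>real^'n \<Rightarrow> real^'n\<close>;
  everything below depends only on their germs, so values outside the open set are irrelevant.
\<close>

type_synonym 'n vfield = "real^'n \<Rightarrow> real^'n"

definition coord_field :: "'n::finite \<Rightarrow> 'n vfield" where
  "coord_field i = (\<lambda>_. axis i 1)"

definition partial :: "'n::finite \<Rightarrow> (real^'n \<Rightarrow> real) \<Rightarrow> real^'n \<Rightarrow> real" where
  "partial i \<phi> p = deriv (\<lambda>t. \<phi> (p + t *\<^sub>R axis i 1)) 0"

definition lie_bracket :: "'n::finite vfield \<Rightarrow> 'n vfield \<Rightarrow> 'n vfield" where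
  "lie_bracket X Y p = frechet_derivative Y (at p) (X p) - frechet_derivative X (at p) (Y p)"

text \<open>
  The affine connection whose value on the coordinate fields number \<open>i\<close> and \<open>j\<close> is \<open>C i j\<close>,
  extended by the Leibniz rule.
\<close>

definition connection :: "('n \<Rightarrow> 'n \<Rightarrow> 'n vfield) \<Rightarrow> 'n::finite vfield \<Rightarrow> 'n vfield \<Rightarrow> 'n vfield" where
  "connection C X Y p =
     frechet_derivative Y (at p) (X p) + (\<Sum>i\<in>UNIV. \<Sum>j\<in>UNIV. (X p $ i * Y p $ j) *\<^sub>R C i j p)"

definition curvature ::
  "('n::finite vfield \<Rightarrow> 'n vfield \<Rightarrow> 'n vfield) \<Rightarrow> 'n vfield \<Rightarrow> 'n vfield \<Rightarrow> 'n vfield \<Rightarrow> 'n vfield" where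
  "curvature D X Y Z p = D X (D Y Z) p - D Y (D X Z) p - D (lie_bracket X Y) Z p"

lemma connection_coord_field: "connection C (coord_field i) (coord_field j) p = C i j p"
proof -
  have "connection C (coord_field i) (coord_field j) p =
    (\<Sum>i'\<in>UNIV. \<Sum>j'\<in>UNIV. if j' = j then (if i' = i then C i j p else 0) else 0)"
    by (simp add: connection_def coord_field_def axis_def if_distrib cong: if_cong)
       (intro sum.cong refl, auto)
  then show ?thesis by simp
qed

lemma connection_linear_left:
  assumes "Y differentiable at p"
  shows "connection C (\<lambda>q. f q *\<^sub>R X q + h q *\<^sub>R X' q) Y p =
    f p *\<^sub>R connection C X Y p + h p *\<^sub>R connection C X' Y p"
  using linear_frechet_derivative[OF assms]
  by (simp add: connection_def linear_add linear_scale algebra_simps sum.distrib scaleR_sum_right)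

lemma connection_add_right:
  assumes "Y differentiable at p" "Y' differentiable at p"
  shows "connection C X (\<lambda>q. Y q + Y' q) p = connection C X Y p + connection C X Y' p"
proof -
  have "((\<lambda>q. Y q + Y' q) has_derivative
      (\<lambda>v. frechet_derivative Y (at p) v + frechet_derivative Y' (at p) v)) (at p)"
    using assms by (intro has_derivative_add) (simp_all flip: frechet_derivative_works)
  from frechet_derivative_at[OF this, symmetric] show ?thesis
    by (simp add: connection_def algebra_simps sum.distrib)
qed

lemma connection_leibniz:
  assumes "f differentiable at p" "Y differentiable at p"
  shows "connection C X (\<lambda>q. f q *\<^sub>R Y q) p =
    frechet_derivative f (at p) (X p) *\<^sub>R Y p + f p *\<^sub>R connection C X Y p"
proof -
  have "((\<lambda>q. f q *\<^sub>R Y q) has_derivative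
      (\<lambda>v. f p *\<^sub>R frechet_derivative Y (at p) v + frechet_derivative f (at p) v *\<^sub>R Y p)) (at p)"
    using assms by (intro has_derivative_scaleR) (simp_all flip: frechet_derivative_works)
  from frechet_derivative_at[OF this, symmetric] show ?thesis
    by (simp add: connection_def algebra_simps scaleR_sum_right)
qed

lemma connection_torsion_free:
  assumes "\<And>i j. C i j p = C j i p"
  shows "connection C X Y p - connection C Y X p = lie_bracket X Y p"
proof -
  have "(\<Sum>i\<in>UNIV. \<Sum>j\<in>UNIV. (X p $ i * Y p $ j) *\<^sub>R C i j p) =
        (\<Sum>i\<in>UNIV. \<Sum>j\<in>UNIV. (Y p $ i * X p $ j) *\<^sub>R C i j p)"
    by (subst sum.swap) (simp add: assms mult.commute)
  then show ?thesis by (simp add: connection_def lie_bracket_def)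
qed


section \<open>The Freund manifold\<close>

text \<open>
  The coordinates \<open>(\<alpha>\<^sub>1, \<beta>\<^sub>1, \<alpha>\<^sub>2, \<beta>\<^sub>2)\<close> of a parameter \<open>p\<close> are \<open>p $ 1, p $ 2, p $ 3, p $ 4\<close>.
\<close>

definition freund_manifold :: "(real^4) set" where
  "freund_manifold = {p. \<forall>i. p $ i > 0}"

definition quadrant :: "(real \<times> real) set" where
  "quadrant = {0<..} \<times> {0<..}"

definition freund_density :: "real^4 \<Rightarrow> real \<times> real \<Rightarrow> real" where
  "freund_density p = (\<lambda>(x, y).
     if 0 < x \<and> x < y then p$1 * p$4 * exp (- p$4 * y - (p$1 + p$3 - p$4) * x)
     else if 0 < y \<and> y \<le> x then p$3 * p$2 * exp (- p$2 * x - (p$1 + p$3 - p$2) * y)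
     else 0)"

definition log_density :: "real \<times> real \<Rightarrow> real^4 \<Rightarrow> real" where
  "log_density z p = ln (freund_density p z)"

definition expect :: "real^4 \<Rightarrow> (real \<times> real \<Rightarrow> real) \<Rightarrow> real" where
  "expect p h = (LINT z:quadrant|lborel. h z * freund_density p z)"

definition fisher :: "4 \<Rightarrow> 4 \<Rightarrow> real^4 \<Rightarrow> real" where
  "fisher i j p = - expect p (\<lambda>z. partial i (partial j (log_density z)) p)"

definition fisher_metric :: "real^4 \<Rightarrow> real^4 \<Rightarrow> real^4 \<Rightarrow> real" where
  "fisher_metric p u v = (\<Sum>i\<in>UNIV. \<Sum>j\<in>UNIV. fisher i j p * u $ i * v $ j)"

definition alpha_gamma :: "real \<Rightarrow> 4 \<Rightarrow> 4 \<Rightarrow> 4 \<Rightarrow> real^4 \<Rightarrow> real" where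
  "alpha_gamma \<alpha> i j k p = expect p (\<lambda>z.
     partial i (partial j (log_density z)) p * partial k (log_density z) p
     + (1 - \<alpha>) / 2 * partial i (log_density z) p * partial j (log_density z) p
         * partial k (log_density z) p)"

text \<open>
  Raising the last index of \<^const>\<open>alpha_gamma\<close>; the vector is unique because the Fisher metric
  is nondegenerate.
\<close>

definition alpha_christoffel :: "real \<Rightarrow> 4 \<Rightarrow> 4 \<Rightarrow> 4 vfield" where
  "alpha_christoffel \<alpha> i j p =
     (THE v. \<forall>k. fisher_metric p v (coord_field k p) = alpha_gamma \<alpha> i j k p)"

definition alpha_connection :: "real \<Rightarrow> 4 vfield \<Rightarrow> 4 vfield \<Rightarrow> 4 vfield" where
  "alpha_connection \<alpha> = connection (alpha_christoffel \<alpha>)"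

definition alpha_curvature :: "real \<Rightarrow> real^4 \<Rightarrow> 4 \<Rightarrow> 4 \<Rightarrow> 4 \<Rightarrow> 4 \<Rightarrow> real" where
  "alpha_curvature \<alpha> p i j k l =
     fisher_metric p
       (curvature (alpha_connection \<alpha>) (coord_field i) (coord_field j) (coord_field k) p)
       (coord_field l p)"

lemma log_density_first:
  assumes "p \<in> freund_manifold" "0 < x" "x < y"
  shows "log_density (x, y) p = ln (p$1) + ln (p$4) - p$4 * y - (p$1 + p$3 - p$4) * x"
proof -
  have "p$1 > 0" "p$4 > 0" using assms by (auto simp: freund_manifold_def)
  with assms show ?thesis by (simp add: log_density_def freund_density_def ln_mult_pos)
qed

lemma log_density_second:
  assumes "p \<in> freund_manifold" "0 < y" "y \<le> x"
  shows "log_density (x, y) p = ln (p$3) + ln (p$2) - p$2 * x - (p$1 + p$3 - p$2) * y"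
proof -
  have "p$3 > 0" "p$2 > 0" using assms by (auto simp: freund_manifold_def)
  with assms show ?thesis by (simp add: log_density_def freund_density_def ln_mult_pos)
qed

lemma open_freund_manifold: "open freund_manifold"
proof -
  have eq: "freund_manifold = (\<Inter>i. {p. 0 < p $ i})" by (auto simp: freund_manifold_def)
  show ?thesis unfolding eq
    by (intro open_INT ballI open_Collect_less continuous_intros finite)
qed

lemma partial_cong:
  assumes "p \<in> freund_manifold" "\<And>q. q \<in> freund_manifold \<Longrightarrow> \<phi> q = \<psi> q"
  shows "partial i \<phi> p = partial i \<psi> p"
proof -
  have "((\<lambda>t. p + t *\<^sub>R axis i 1) \<longlongrightarrow> p + 0 *\<^sub>R axis i 1) (nhds (0::real))"
    by (intro tendsto_intros) (rule filterlim_ident)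
  then have "\<forall>\<^sub>F t in nhds (0::real). p + t *\<^sub>R axis i 1 \<in> freund_manifold"
    using open_freund_manifold assms(1) by (auto dest: topological_tendstoD)
  then have "\<forall>\<^sub>F t in nhds (0::real). \<phi> (p + t *\<^sub>R axis i 1) = \<psi> (p + t *\<^sub>R axis i 1)"
    by (rule eventually_mono) (rule assms(2))
  then show ?thesis unfolding partial_def by (intro deriv_cong_ev) auto
qed

lemma partial_log_density_first:
  assumes "p \<in> freund_manifold" "0 < x" "x < y"
  shows "partial j (log_density (x, y)) p =
    (if j = 1 then 1 / p$1 - x else if j = 2 then 0 else if j = 3 then - x else 1 / p$4 - y + x)"
proof -
  have pos: "p$1 > 0" "p$4 > 0" using assms by (auto simp: freund_manifold_def)
  have "partial j (log_density (x, y)) p =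
    partial j (\<lambda>q. ln (q$1) + ln (q$4) - q$4 * y - (q$1 + q$3 - q$4) * x) p"
    by (rule partial_cong) (use assms log_density_first in auto)
  also have "\<dots> = (if j = 1 then 1 / p$1 - x else if j = 2 then 0 else if j = 3 then - x
      else 1 / p$4 - y + x)"
    unfolding partial_def using exhaust_4[of j] pos
    by (intro DERIV_imp_deriv)
       (auto simp: axis_def algebra_simps intro!: derivative_eq_intros)
  finally show ?thesis .
qed

lemma partial_log_density_second:
  assumes "p \<in> freund_manifold" "0 < y" "y \<le> x"
  shows "partial j (log_density (x, y)) p =
    (if j = 1 then - y else if j = 2 then 1 / p$2 - x + y else if j = 3 then 1 / p$3 - y else 0)"
proof -
  have pos: "p$3 > 0" "p$2 > 0" using assms by (auto simp: freund_manifold_def)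
  have "partial j (log_density (x, y)) p =
    partial j (\<lambda>q. ln (q$3) + ln (q$2) - q$2 * x - (q$1 + q$3 - q$2) * y) p"
    by (rule partial_cong) (use assms log_density_second in auto)
  also have "\<dots> = (if j = 1 then - y else if j = 2 then 1 / p$2 - x + y
      else if j = 3 then 1 / p$3 - y else 0)"
    unfolding partial_def using exhaust_4[of j] pos
    by (intro DERIV_imp_deriv)
       (auto simp: axis_def algebra_simps intro!: derivative_eq_intros)
  finally show ?thesis .
qed

lemma partial2_log_density_off_diagonal:
  assumes "p \<in> freund_manifold" "z \<in> quadrant" "i \<noteq> j"
  shows "partial i (partial j (log_density z)) p = 0"
proof -
  obtain x y where z: "z = (x, y)" "0 < x" "0 < y" using assms(2) by (auto simp: quadrant_def)
  show ?thesis
  proof (cases "x < y")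
    case True
    have "partial i (partial j (log_density z)) p = partial i (\<lambda>q. if j = 1 then 1 / q$1 - x
        else if j = 2 then 0 else if j = 3 then - x else 1 / q$4 - y + x) p"
      by (rule partial_cong) (use assms z True partial_log_density_first in auto)
    also have "\<dots> = 0"
      unfolding partial_def using exhaust_4[of j] assms(3) by (auto simp: axis_def)
    finally show ?thesis .
  next
    case False
    have "partial i (partial j (log_density z)) p = partial i (\<lambda>q. if j = 1 then - y
        else if j = 2 then 1 / q$2 - x + y else if j = 3 then 1 / q$3 - y else 0) p"
      by (rule partial_cong) (use assms z False partial_log_density_second in auto)
    also have "\<dots> = 0"
      unfolding partial_def using exhaust_4[of j] assms(3) by (auto simp: axis_def)
    finally show ?thesis .
  qed
qed

lemma alpha_christoffel_sym:
  assumes "p \<in> freund_manifold"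
  shows "alpha_christoffel \<alpha> i j p = alpha_christoffel \<alpha> j i p"
proof -
  have "partial i (partial j (log_density z)) p = partial j (partial i (log_density z)) p"
    if "z \<in> quadrant" for z
    using that assms by (cases "i = j") (auto simp: partial2_log_density_off_diagonal)
  then have "alpha_gamma \<alpha> i j k p = alpha_gamma \<alpha> j i k p" for k
    unfolding alpha_gamma_def expect_def set_lebesgue_integral_def
    by (intro Bochner_Integration.integral_cong refl) (auto simp: indicator_def mult_ac)
  then show ?thesis by (simp add: alpha_christoffel_def)
qed

lemma alpha_connection_torsion_free:
  assumes "p \<in> freund_manifold"
  shows "alpha_connection \<alpha> X Y p - alpha_connection \<alpha> Y X p = lie_bracket X Y p"
  unfolding alpha_connection_def
  by (rule connection_torsion_free) (rule alpha_christoffel_sym[OF assms])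


section \<open>Index symmetries\<close>

text \<open>All index quadruples obtained from those in \<open>S\<close> by the symmetries
  \<open>R\<^sub>i\<^sub>j\<^sub>k\<^sub>l = - R\<^sub>j\<^sub>i\<^sub>k\<^sub>l = - R\<^sub>i\<^sub>j\<^sub>l\<^sub>k = R\<^sub>k\<^sub>l\<^sub>i\<^sub>j\<close>.\<close>

inductive_set symmetry_closure :: "('n \<times> 'n \<times> 'n \<times> 'n) set \<Rightarrow> ('n \<times> 'n \<times> 'n \<times> 'n) set"
  for S where
  base: "s \<in> S \<Longrightarrow> s \<in> symmetry_closure S"
| swap_first: "(i, j, k, l) \<in> symmetry_closure S \<Longrightarrow> (j, i, k, l) \<in> symmetry_closure S"
| swap_last: "(i, j, k, l) \<in> symmetry_closure S \<Longrightarrow> (i, j, l, k) \<in> symmetry_closure S"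
| swap_pairs: "(i, j, k, l) \<in> symmetry_closure S \<Longrightarrow> (k, l, i, j) \<in> symmetry_closure S"

end

theory Submission
  imports Defs "HOL-Probability.Distributions" "HOL-Computational_Algebra.Polynomial"
begin

text \<open>
  In the variables \<open>u = min x y\<close> and \<open>v = \<bar>x - y\<bar>\<close> the Freund density splits: \<open>u\<close> is exponential of
  rate \<open>s = \<alpha>\<^sub>1 + \<alpha>\<^sub>2\<close>, the event \<open>x < y\<close> has probability \<open>\<alpha>\<^sub>1 / s\<close> independently of \<open>u\<close>, and given the
  event \<open>v\<close> is exponential of rate \<open>\<beta>\<^sub>2\<close> or \<open>\<beta>\<^sub>1\<close>. On each branch every score \<open>\<partial>\<^sub>k log f\<close> is a polynomial in
  \<open>u\<close> times a polynomial in \<open>v\<close>, so all expectations reduce to moments of exponential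
  distributions. The Fisher metric is therefore diagonal, the Christoffel symbols are explicit rational
  functions, and the curvature turns out to be a sum of three squares of 2-forms, from which its
  index symmetries and vanishing components can be read off.
\<close>

section \<open>Expectations\<close>

text \<open>The mean of \<open>poly q\<close> under the exponential law of rate \<open>l\<close>,
  whose \<open>i\<close>-th moment is \<open>fact i / l ^ i\<close>.\<close>

definition exp_mean :: "real \<Rightarrow> real poly \<Rightarrow> real" where
  "exp_mean l q = (\<Sum>i\<le>degree q. coeff q i * fact i / l ^ i)"

text \<open>
  Vanishing at \<open>0\<close>, in contrast to \<^const>\<open>erlang_density\<close>, makes the factorisation of the Freund density
  hold everywhere and not just almost everywhere.
\<close>

definition pos_exponential_density :: "real \<Rightarrow> real \<Rightarrow> real" where
  "pos_exponential_density l x = (if 0 < x then l * exp (- l * x) else 0)"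

text \<open>Any degree bound serves, so a coefficient list can be evaluated without asking whether
  its last entry vanishes.\<close>

lemma exp_mean_altdef:
  assumes "degree q \<le> n"
  shows "exp_mean l q = (\<Sum>i\<le>n. coeff q i * fact i / l ^ i)"
  unfolding exp_mean_def using assms
  by (intro sum.mono_neutral_left) (auto simp: coeff_eq_0)

lemma has_bochner_integral_exponential_poly:
  assumes "0 < l"
  shows "has_bochner_integral lborel (\<lambda>x. exponential_density l x * poly q x) (exp_mean l q)"
proof -
  have "has_bochner_integral lborel (\<lambda>x. exponential_density l x * x ^ i) (fact i / l ^ i)" for i
    \<comment> \<open>The Erlang law of shape \<open>0\<close> is the exponential law; the integrand
      is nonnegative, so its nonnegative integral gives integrability and value at once.\<close>
    using nn_integral_erlang_ith_moment[OF assms, of 0 i] assms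
    by (intro has_bochner_integral_nn_integral) (auto simp: erlang_density_def)
  then have "has_bochner_integral lborel
      (\<lambda>x. \<Sum>i\<le>degree q. coeff q i * (exponential_density l x * x ^ i))
      (\<Sum>i\<le>degree q. coeff q i * (fact i / l ^ i))"
    by (intro has_bochner_integral_sum has_bochner_integral_mult_right)
  then show ?thesis
    by (simp add: exp_mean_def poly_altdef sum_distrib_left mult_ac)
qed

lemma has_bochner_integral_pos_exponential_poly:
  assumes "0 < l"
  shows "has_bochner_integral lborel (\<lambda>x. pos_exponential_density l x * poly q x) (exp_mean l q)"
proof -
  have m: "(\<lambda>x. pos_exponential_density l x * poly q x) \<in> borel_measurable lborel"
  proof -
    have [measurable]: "(\<lambda>x. poly q x) \<in> borel_measurable borel"
      by (intro borel_measurable_continuous_onI continuous_intros)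
    show ?thesis unfolding pos_exponential_density_def by measurable
  qed
  have "AE x in lborel. exponential_density l x * poly q x = pos_exponential_density l x * poly q x"
    using AE_lborel_singleton[of "0::real"]
    by eventually_elim (auto simp: erlang_density_def pos_exponential_density_def)
  moreover note E = has_bochner_integral_exponential_poly[OF assms, of q]
  ultimately show ?thesis
    using has_bochner_integral_cong_AE[OF borel_measurable_has_bochner_integral[OF E] m] by blast
qed

text \<open>The substitution v = y - x needs no change of variables in the plane: by Fubini the
  inner integral over y is a translate of the integral of \<open>G\<close>, hence free of x.\<close>

lemma has_bochner_integral_shear:
  fixes F G :: "real \<Rightarrow> real"
  assumes F: "has_bochner_integral lborel F a" and G: "has_bochner_integral lborel G b"
  shows "has_bochner_integral lborel (\<lambda>(x, y). F x * G (y - x)) (a * b)"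
proof -
  let ?H = "\<lambda>(x, y). F x * G (y - x)"
  have [measurable]: "F \<in> borel_measurable borel" "G \<in> borel_measurable borel"
    using F G by (auto dest!: borel_measurable_has_bochner_integral)
  have Gi: "integrable lborel G" and Fi: "integrable lborel F"
    using F G by (auto simp: has_bochner_integral_iff)
  have shift: "integrable lborel (\<lambda>y. G (y - x))" "(\<integral>y. G (y - x) \<partial>lborel) = b"
    "(\<integral>y. \<bar>G (y - x)\<bar> \<partial>lborel) = (\<integral>y. \<bar>G y\<bar> \<partial>lborel)" for x
    using lborel_integrable_real_affine[OF Gi, of 1 "- x"]
      lborel_integral_real_affine[of 1 G "- x"] lborel_integral_real_affine[of 1 "\<lambda>y. \<bar>G y\<bar>" "- x"] G
    by (simp_all add: has_bochner_integral_iff)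
  have int: "integrable (lborel \<Otimes>\<^sub>M lborel) ?H"
  proof (rule lborel_pair.Fubini_integrable)
    show "integrable lborel (\<lambda>x. \<integral>y. norm (?H (x, y)) \<partial>lborel)"
      using Fi by (simp add: abs_mult shift)
    show "AE x in lborel. integrable lborel (\<lambda>y. ?H (x, y))"
      using shift by simp
  qed measurable
  have "integral\<^sup>L (lborel \<Otimes>\<^sub>M lborel) ?H = a * b"
    using lborel_pair.integral_fst'[OF int] F by (simp add: shift has_bochner_integral_iff)
  with int show ?thesis by (simp add: has_bochner_integral_iff lborel_prod)
qed

lemma has_bochner_integral_shear':
  fixes F G :: "real \<Rightarrow> real"
  assumes F: "has_bochner_integral lborel F a" and G: "has_bochner_integral lborel G b"
  shows "has_bochner_integral lborel (\<lambda>(x, y). F y * G (x - y)) (a * b)"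
proof -
  let ?H = "\<lambda>(x, y). F x * G (y - x)"
  have H: "integrable (lborel \<Otimes>\<^sub>M lborel) ?H" "integral\<^sup>L (lborel \<Otimes>\<^sub>M lborel) ?H = a * b"
    using has_bochner_integral_shear[OF F G] by (simp_all add: has_bochner_integral_iff lborel_prod)
  show ?thesis
    using lborel_pair.integrable_product_swap[OF H(1)]
      lborel_pair.integral_product_swap[OF borel_measurable_integrable[OF H(1)]] H(2)
    by (simp add: has_bochner_integral_iff lborel_prod)
qed

section \<open>Expectations under the Freund density\<close>

definition branch_poly ::
  "real poly \<Rightarrow> real poly \<Rightarrow> real poly \<Rightarrow> real poly \<Rightarrow> real \<times> real \<Rightarrow> real" where
  "branch_poly f g f' g' = (\<lambda>(x, y).
     if x < y then poly f x * poly g (y - x) else poly f' y * poly g' (x - y))"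

text \<open>Total expectation over the two branches; on each of them the min and gap factors are
  independent, so their means multiply.\<close>

definition freund_mean ::
  "real^4 \<Rightarrow> real poly \<Rightarrow> real poly \<Rightarrow> real poly \<Rightarrow> real poly \<Rightarrow> real" where
  "freund_mean p f g f' g' =
     (p$1 * (exp_mean (p$1 + p$3) f * exp_mean (p$4) g) +
      p$3 * (exp_mean (p$1 + p$3) f' * exp_mean (p$2) g')) / (p$1 + p$3)"

lemma has_bochner_integral_branch_poly:
  assumes "p \<in> freund_manifold"
  shows "has_bochner_integral lborel
    (\<lambda>z. indicator quadrant z *\<^sub>R (branch_poly f g f' g' z * freund_density p z))
    (freund_mean p f g f' g')"
proof -
  have pos: "p$i > 0" for i using assms by (simp add: freund_manifold_def)
  define s where "s = p$1 + p$3"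
  have s: "s > 0" using pos by (simp add: s_def add_pos_pos)
  let ?E = "\<lambda>q x. pos_exponential_density s x * poly q x"
  let ?H = "\<lambda>(x, y). ?E f x * (pos_exponential_density (p$4) (y - x) * poly g (y - x))"
  \<comment> \<open>The diagonal belongs to the branch y \<le> x, so this gap density must be
    positive at \<open>0\<close>, whereas the one in \<open>?H\<close> must vanish there.\<close>
  let ?H' = "\<lambda>(x, y). ?E f' y * (exponential_density (p$2) (x - y) * poly g' (x - y))"
  have "has_bochner_integral lborel (\<lambda>z. p$1 / s * ?H z + p$3 / s * ?H' z)
      (p$1 / s * (exp_mean s f * exp_mean (p$4) g) + p$3 / s * (exp_mean s f' * exp_mean (p$2) g'))"
    by (intro has_bochner_integral_add has_bochner_integral_mult_right has_bochner_integral_shear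
        has_bochner_integral_shear' has_bochner_integral_pos_exponential_poly
        has_bochner_integral_exponential_poly pos s)
  also have "(\<lambda>z. p$1 / s * ?H z + p$3 / s * ?H' z) =
      (\<lambda>z. indicator quadrant z *\<^sub>R (branch_poly f g f' g' z * freund_density p z))"
  proof
    fix z :: "real \<times> real"
    obtain x y where z: "z = (x, y)" by (cases z)
    \<comment> \<open>Regrouping the exponent in terms of min and gap is what separates the
      density.\<close>
    have "exp (- (p$4 * y) - (s - p$4) * x) = exp (- (s * x)) * exp (- (p$4 * (y - x)))"
      "exp (- (p$2 * x) - (s - p$2) * y) = exp (- (s * y)) * exp (- (p$2 * (x - y)))"
      by (simp_all add: mult_exp_exp algebra_simps)
    then show "p$1 / s * ?H z + p$3 / s * ?H' z =
        indicator quadrant z *\<^sub>R (branch_poly f g f' g' z * freund_density p z)"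
      using s by (auto simp: z branch_poly_def freund_density_def quadrant_def indicator_def
          pos_exponential_density_def erlang_density_def s_def[symmetric])
  qed
  also have "p$1 / s * (exp_mean s f * exp_mean (p$4) g) + p$3 / s * (exp_mean s f' * exp_mean (p$2) g')
      = freund_mean p f g f' g'"
    by (simp add: freund_mean_def s_def add_divide_distrib)
  finally show ?thesis .
qed

text \<open>Shaped after the integrand of \<open>alpha_gamma\<close>: a Hessian-times-score term
  plus a weight times a product of three scores.\<close>

lemma expect_branch_poly:
  assumes p: "p \<in> freund_manifold"
    and h: "\<And>x y. 0 < x \<Longrightarrow> 0 < y \<Longrightarrow>
      h (x, y) = branch_poly f g f' g' (x, y) + c * branch_poly k l k' l' (x, y)"
  shows "expect p h = freund_mean p f g f' g' + c * freund_mean p k l k' l'"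
proof -
  have "has_bochner_integral lborel (\<lambda>z.
      indicator quadrant z *\<^sub>R (branch_poly f g f' g' z * freund_density p z) +
      c * (indicator quadrant z *\<^sub>R (branch_poly k l k' l' z * freund_density p z)))
      (freund_mean p f g f' g' + c * freund_mean p k l k' l')"
    by (intro has_bochner_integral_add has_bochner_integral_mult_right
        has_bochner_integral_branch_poly p)
  also have "(\<lambda>z.
      indicator quadrant z *\<^sub>R (branch_poly f g f' g' z * freund_density p z) +
      c * (indicator quadrant z *\<^sub>R (branch_poly k l k' l' z * freund_density p z))) =
      (\<lambda>z. indicator quadrant z *\<^sub>R (h z * freund_density p z))"
    using h by (auto simp: fun_eq_iff quadrant_def indicator_def algebra_simps)
  finally show ?thesis
    unfolding expect_def set_lebesgue_integral_def by (rule has_bochner_integral_integral_eq)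
qed

section \<open>Fisher metric and Christoffel symbols\<close>

text \<open>
  The \<open>k\<close>-th score is the product of its \<open>min\<close> factor, a polynomial in \<open>min x y\<close>, and its \<open>gap\<close> factor,
  a polynomial in \<open>\<bar>x - y\<bar>\<close>; the suffixes \<open>lt\<close> and \<open>ge\<close> refer to the branches \<open>x < y\<close> and \<open>y \<le> x\<close>.
\<close>

definition min_score_lt :: "real^4 \<Rightarrow> 4 \<Rightarrow> real poly" where
  "min_score_lt p k =
     (if k = 1 then [:1 / p$1, - 1:] else if k = 3 then [:0, - 1:] else if k = 4 then 1 else 0)"

definition gap_score_lt :: "real^4 \<Rightarrow> 4 \<Rightarrow> real poly" where
  "gap_score_lt p k = (if k = 4 then [:1 / p$4, - 1:] else 1)"

definition min_score_ge :: "real^4 \<Rightarrow> 4 \<Rightarrow> real poly" where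
  "min_score_ge p k =
     (if k = 1 then [:0, - 1:] else if k = 3 then [:1 / p$3, - 1:] else if k = 2 then 1 else 0)"

definition gap_score_ge :: "real^4 \<Rightarrow> 4 \<Rightarrow> real poly" where
  "gap_score_ge p k = (if k = 2 then [:1 / p$2, - 1:] else 1)"

text \<open>On a branch, \<open>log_density\<close> is a sum of two logarithms of coordinates and
  terms linear in the parameter, so its Hessian is diagonal and does not depend on the point (x,
  y).\<close>

definition hess_lt :: "real^4 \<Rightarrow> 4 \<Rightarrow> 4 \<Rightarrow> real" where
  "hess_lt p i j = (if i = j \<and> (i = 1 \<or> i = 4) then - 1 / (p$i)\<^sup>2 else 0)"

definition hess_ge :: "real^4 \<Rightarrow> 4 \<Rightarrow> 4 \<Rightarrow> real" where
  "hess_ge p i j = (if i = j \<and> (i = 2 \<or> i = 3) then - 1 / (p$i)\<^sup>2 else 0)"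

lemma partial_log_density_branch:
  assumes "p \<in> freund_manifold" "0 < x" "0 < y"
  shows "partial j (log_density (x, y)) p =
    branch_poly (min_score_lt p j) (gap_score_lt p j) (min_score_ge p j) (gap_score_ge p j) (x, y)"
  using partial_log_density_first[OF assms(1,2), of y j] partial_log_density_second[OF assms(1,3), of x j]
    exhaust_4[of j]
  by (auto simp: branch_poly_def min_score_lt_def gap_score_lt_def min_score_ge_def gap_score_ge_def)

lemma partial2_log_density_branch:
  assumes p: "p \<in> freund_manifold" and xy: "0 < x" "0 < y"
  shows "partial i (partial j (log_density (x, y))) p =
    (if x < y then hess_lt p i j else hess_ge p i j)"
proof (cases "i = j")
  case False
  then show ?thesis
    using partial2_log_density_off_diagonal[OF p, of "(x, y)" i j] xy
    by (simp add: quadrant_def hess_lt_def hess_ge_def)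
next
  case [simp]: True
  have pos: "p$k > 0" for k using p by (simp add: freund_manifold_def)
  have "partial i (partial j (log_density (x, y))) p = partial j (\<lambda>q. branch_poly
      (min_score_lt q j) (gap_score_lt q j) (min_score_ge q j) (gap_score_ge q j) (x, y)) p"
    unfolding True by (rule partial_cong[OF p]) (rule partial_log_density_branch[OF _ xy])
  also have "\<dots> = (if x < y then hess_lt p i j else hess_ge p i j)"
    unfolding partial_def using exhaust_4[of j] pos[of 1] pos[of 2] pos[of 3] pos[of 4]
    by (intro DERIV_imp_deriv)
       (auto simp: branch_poly_def min_score_lt_def gap_score_lt_def min_score_ge_def gap_score_ge_def
          hess_lt_def hess_ge_def axis_def power2_eq_square intro!: derivative_eq_intros)
  finally show ?thesis .
qed

section \<open>Exponential means of polynomials up to degree three\<close>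

lemma exp_mean_const: "exp_mean l [:a:] = a" "exp_mean l 1 = 1" "exp_mean l 0 = 0"
  by (simp_all add: exp_mean_def)

lemma exp_mean_pCons2: "exp_mean l [:a, b:] = a + b / l"
  by (subst exp_mean_altdef[of _ 1]) simp_all

lemma exp_mean_pCons3: "exp_mean l [:a, b, c:] = a + b / l + 2 * c / l\<^sup>2"
  by (subst exp_mean_altdef[of _ 2]) (simp_all add: eval_nat_numeral)

text \<open>Degree three is the largest that occurs: every score factor is at most linear, and at
  most three are multiplied.\<close>

lemma exp_mean_pCons4: "exp_mean l [:a, b, c, d:] = a + b / l + 2 * c / l\<^sup>2 + 6 * d / l ^ 3"
  by (subst exp_mean_altdef[of _ 3]) (simp_all add: eval_nat_numeral fact_numeral mult_ac)

lemmas exp_mean_simps = exp_mean_const exp_mean_pCons2 exp_mean_pCons3 exp_mean_pCons4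

text \<open>Entry \<open>k\<close> is 1 / (p$k)^2 times the probability of the branch whose log
  density contains \<open>ln (p$k)\<close>.\<close>

definition fisher_diag :: "real^4 \<Rightarrow> 4 \<Rightarrow> real" where
  "fisher_diag p k =
     (if k = 1 then 1 / (p$1 * (p$1 + p$3))
      else if k = 2 then p$3 / ((p$1 + p$3) * (p$2)\<^sup>2)
      else if k = 3 then 1 / (p$3 * (p$1 + p$3))
      else p$1 / ((p$1 + p$3) * (p$4)\<^sup>2))"

lemma fisher_eq:
  assumes p: "p \<in> freund_manifold"
  shows "fisher i j p = (if i = j then fisher_diag p i else 0)"
proof -
  have pos: "p$k > 0" for k using p by (simp add: freund_manifold_def)
  \<comment> \<open>The Hessian is constant on each branch; the null second term only matches the
    shape of \<open>expect_branch_poly\<close>.\<close>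
  have "fisher i j p = - (freund_mean p [:hess_lt p i j:] 1 [:hess_ge p i j:] 1 + 0 * freund_mean p 0 0 0 0)"
    unfolding fisher_def
    by (intro arg_cong[of _ _ uminus] expect_branch_poly[OF p])
       (simp add: partial2_log_density_branch[OF p] branch_poly_def)
  also have "\<dots> = (if i = j then fisher_diag p i else 0)"
    using exhaust_4[of i] pos[of 1] pos[of 2] pos[of 3] pos[of 4]
    by (auto simp: freund_mean_def exp_mean_simps hess_lt_def hess_ge_def fisher_diag_def
        divide_simps power2_eq_square)
  finally show ?thesis .
qed

lemma fisher_diag_pos: "p \<in> freund_manifold \<Longrightarrow> 0 < fisher_diag p k"
  by (auto simp: fisher_diag_def freund_manifold_def
      intro!: divide_pos_pos mult_pos_pos add_pos_pos zero_less_power)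

lemma fisher_metric_coord_field:
  assumes "p \<in> freund_manifold"
  shows "fisher_metric p v (coord_field k p) = fisher_diag p k * v $ k"
  using exhaust_4[of k]
  by (auto simp: fisher_metric_def fisher_eq[OF assms] coord_field_def axis_def sum_4)

text \<open>The weight \<open>c\<close> below stands for \<open>(1 - \<alpha>) / 2\<close>.\<close>

definition christoffel :: "real \<Rightarrow> real^4 \<Rightarrow> 4 \<Rightarrow> 4 \<Rightarrow> 4 \<Rightarrow> real" where
  "christoffel c p i j k = (let s = p$1 + p$3 in
     if i = j then
       (if i = 1 then
          (if k = 1 then (1 - 3 * c) * (1 / s) - (1 - c) * (1 / p$1)
           else if k = 3 then (1 - c) * (1 / p$1 - 1 / s) else 0)
        else if i = 3 then
          (if k = 3 then (1 - 3 * c) * (1 / s) - (1 - c) * (1 / p$3)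
           else if k = 1 then (1 - c) * (1 / p$3 - 1 / s) else 0)
        else if i = 2 then
          (if k = 1 then (1 - c) * (p$1 * p$3 / (s * (p$2)\<^sup>2))
           else if k = 3 then - (1 - c) * (p$1 * p$3 / (s * (p$2)\<^sup>2))
           else if k = 2 then - 2 * c * (1 / p$2) else 0)
        else
          (if k = 1 then - (1 - c) * (p$1 * p$3 / (s * (p$4)\<^sup>2))
           else if k = 3 then (1 - c) * (p$1 * p$3 / (s * (p$4)\<^sup>2))
           else if k = 4 then - 2 * c * (1 / p$4) else 0))
     else if {i, j} = {1, 3} then (if k = 1 \<or> k = 3 then - c * (1 / s) else 0)
     else if {i, j} = {1, 2} then (if k = 2 then - c * (1 / s) else 0)
     else if {i, j} = {2, 3} then (if k = 2 then c * (1 / p$3 - 1 / s) else 0)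
     else if {i, j} = {1, 4} then (if k = 4 then c * (1 / p$1 - 1 / s) else 0)
     else if {i, j} = {3, 4} then (if k = 4 then - c * (1 / s) else 0)
     else 0)"

lemma freund_manifold_nonzero:
  assumes "p \<in> freund_manifold"
  shows "p$n \<noteq> 0" "p$1 + p$3 \<noteq> 0"
proof -
  have pos: "p$k > 0" for k using assms by (simp add: freund_manifold_def)
  show "p$n \<noteq> 0" "p$1 + p$3 \<noteq> 0"
    using pos[of n] add_pos_pos[OF pos[of 1] pos[of 3]] by linarith+
qed

text \<open>Since the metric is diagonal, \<open>christoffel\<close> (upper index last) comes from
  \<open>alpha_gamma\<close> by dividing by \<open>fisher_diag p k\<close>. Each of the 64 index
  triples is an identity of rational functions.\<close>

lemma alpha_gamma_eq:
  assumes p: "p \<in> freund_manifold"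
  shows "alpha_gamma \<alpha> i j k p = fisher_diag p k * christoffel ((1 - \<alpha>) / 2) p i j k"
proof -
  define c where "c = (1 - \<alpha>) / 2"
  note [simp] = freund_manifold_nonzero[OF p]
  have "alpha_gamma \<alpha> i j k p =
      freund_mean p (smult (hess_lt p i j) (min_score_lt p k)) (gap_score_lt p k)
        (smult (hess_ge p i j) (min_score_ge p k)) (gap_score_ge p k)
      + c * freund_mean p
        (min_score_lt p i * min_score_lt p j * min_score_lt p k)
        (gap_score_lt p i * gap_score_lt p j * gap_score_lt p k)
        (min_score_ge p i * min_score_ge p j * min_score_ge p k)
        (gap_score_ge p i * gap_score_ge p j * gap_score_ge p k)"
    unfolding alpha_gamma_def
    by (rule expect_branch_poly[OF p])
       (simp add: partial2_log_density_branch[OF p] partial_log_density_branch[OF p]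
         branch_poly_def c_def)
  also have "\<dots> = fisher_diag p k * christoffel c p i j k"
    using exhaust_4[of i] exhaust_4[of j] exhaust_4[of k]
    by (elim disjE; simp add: freund_mean_def exp_mean_simps hess_lt_def hess_ge_def fisher_diag_def
          min_score_lt_def gap_score_lt_def min_score_ge_def gap_score_ge_def christoffel_def Let_def
          doubleton_eq_iff)
       (simp_all add: divide_simps power2_eq_square power3_eq_cube, simp_all add: algebra_simps)
  finally show ?thesis by (simp add: c_def)
qed

lemma alpha_christoffel_eq:
  assumes p: "p \<in> freund_manifold"
  shows "alpha_christoffel \<alpha> i j p = (\<chi> k. christoffel ((1 - \<alpha>) / 2) p i j k)"
  unfolding alpha_christoffel_def
proof (rule the_equality)
  show "\<forall>k. fisher_metric p (\<chi> k. christoffel ((1 - \<alpha>) / 2) p i j k) (coord_field k p) =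
      alpha_gamma \<alpha> i j k p"
    by (simp add: fisher_metric_coord_field[OF p] alpha_gamma_eq[OF p])
next
  fix v
  assume "\<forall>k. fisher_metric p v (coord_field k p) = alpha_gamma \<alpha> i j k p"
  then show "v = (\<chi> k. christoffel ((1 - \<alpha>) / 2) p i j k)"
    \<comment> \<open>Uniqueness: the diagonal entries are nonzero, so they cancel in every
      component.\<close>
    using fisher_diag_pos[OF p]
    by (simp add: fisher_metric_coord_field[OF p] alpha_gamma_eq[OF p] vec_eq_iff less_le)
qed

text \<open>Here \<open>v\<close> is the direction. \<open>ds\<close>, \<open>d1\<close>,
  \<open>d3\<close> are the derivatives of 1/s, 1/p$1, 1/p$3; \<open>dw\<close> is that of p$1 * p$3
  / s, and \<open>w2\<close>, \<open>w4\<close> are those of the same quotient divided by (p$2)^2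
  and (p$4)^2.\<close>

definition christoffel_deriv ::
  "real \<Rightarrow> real^4 \<Rightarrow> 4 \<Rightarrow> 4 \<Rightarrow> 4 \<Rightarrow> real^4 \<Rightarrow> real" where
  "christoffel_deriv c p i j k v = (let s = p$1 + p$3;
     ds = - (v$1 + v$3) / s\<^sup>2;
     d1 = - v$1 / (p$1)\<^sup>2;
     d3 = - v$3 / (p$3)\<^sup>2;
     dw = (p$1)\<^sup>2 * v$3 / s\<^sup>2 + (p$3)\<^sup>2 * v$1 / s\<^sup>2;
     w2 = dw / (p$2)\<^sup>2 - 2 * p$1 * p$3 * v$2 / (s * (p$2) ^ 3);
     w4 = dw / (p$4)\<^sup>2 - 2 * p$1 * p$3 * v$4 / (s * (p$4) ^ 3)
   in
     if i = j then
       (if i = 1 then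
          (if k = 1 then (1 - 3 * c) * ds - (1 - c) * d1
           else if k = 3 then (1 - c) * (d1 - ds) else 0)
        else if i = 3 then
          (if k = 3 then (1 - 3 * c) * ds - (1 - c) * d3
           else if k = 1 then (1 - c) * (d3 - ds) else 0)
        else if i = 2 then
          (if k = 1 then (1 - c) * w2
           else if k = 3 then - (1 - c) * w2
           else if k = 2 then - 2 * c * (- v$2 / (p$2)\<^sup>2) else 0)
        else
          (if k = 1 then - (1 - c) * w4
           else if k = 3 then (1 - c) * w4
           else if k = 4 then - 2 * c * (- v$4 / (p$4)\<^sup>2) else 0))
     else if {i, j} = {1, 3} then (if k = 1 \<or> k = 3 then - c * ds else 0)
     else if {i, j} = {1, 2} then (if k = 2 then - c * ds else 0)
     else if {i, j} = {2, 3} then (if k = 2 then c * (d3 - ds) else 0)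
     else if {i, j} = {1, 4} then (if k = 4 then c * (d1 - ds) else 0)
     else if {i, j} = {3, 4} then (if k = 4 then - c * ds else 0)
     else 0)"

text \<open>Every entry is a combination, with coefficients free of the point, of 1/p$n, 1/s and p$1
  * p$3 / (s * (p$n)^2); only these three need differentiating.\<close>

lemma has_derivative_christoffel:
  assumes p: "p \<in> freund_manifold"
  shows "((\<lambda>q. christoffel c q i j k) has_derivative christoffel_deriv c p i j k) (at p)"
proof -
  note [simp] = freund_manifold_nonzero[OF p]
  have nth: "((\<lambda>q. q $ n) has_derivative (\<lambda>v. v $ n)) (at p)" for n :: 4
    by (intro bounded_linear.has_derivative[OF bounded_linear_vec_nth] has_derivative_ident)
  have inv: "((\<lambda>q. 1 / q $ n) has_derivative (\<lambda>v. - v $ n / (p $ n)\<^sup>2)) (at p)" for n :: 4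
    by (rule derivative_eq_intros nth refl | simp add: power2_eq_square)+
  have invs: "((\<lambda>q. 1 / (q$1 + q$3)) has_derivative (\<lambda>v. - (v$1 + v$3) / (p$1 + p$3)\<^sup>2)) (at p)"
    by (rule derivative_eq_intros nth refl | simp add: power2_eq_square)+
  have invb: "((\<lambda>q. q$1 * q$3 / ((q$1 + q$3) * (q$n)\<^sup>2)) has_derivative (\<lambda>v.
      ((p$1)\<^sup>2 * v$3 / (p$1 + p$3)\<^sup>2 + (p$3)\<^sup>2 * v$1 / (p$1 + p$3)\<^sup>2) / (p$n)\<^sup>2
      - 2 * p$1 * p$3 * v$n / ((p$1 + p$3) * (p$n) ^ 3))) (at p)" for n :: 4
    by (rule derivative_eq_intros nth refl | simp)+
       (simp add: fun_eq_iff divide_simps power2_eq_square power3_eq_cube; simp add: algebra_simps)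
  \<comment> \<open>The case conditions concern indices only, so they are constant in the
    point.\<close>
  have If: "((\<lambda>q. if b then f q else g q) has_derivative (\<lambda>v. if b then f' v else g' v)) (at p)"
    if "(f has_derivative f') (at p)" "(g has_derivative g') (at p)"
    for b and f f' g g' :: "real^4 \<Rightarrow> real"
    using that by (cases b) simp_all
  show ?thesis
    unfolding christoffel_def christoffel_deriv_def Let_def
    by (intro If has_derivative_diff has_derivative_mult_right inv invs invb has_derivative_const)
qed

section \<open>Curvature\<close>

text \<open>The classical coordinate formula; the bracket term drops out because coordinate fields
  commute. Agreement of \<open>C\<close> with \<open>G\<close> on an open set suffices, as the
  derivative at \<open>p\<close> is local.\<close>

lemma curvature_coord_fields:
  fixes C :: "'n::finite \<Rightarrow> 'n \<Rightarrow> 'n vfield" and G' :: "'n \<Rightarrow> 'n \<Rightarrow> 'n \<Rightarrow> real^'n \<Rightarrow> real"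
  assumes "open S" "p \<in> S"
    and C: "\<And>i j q. q \<in> S \<Longrightarrow> C i j q = (\<chi> l. G q i j l)"
    and G: "\<And>i j l. ((\<lambda>q. G q i j l) has_derivative G' i j l) (at p)"
  shows "curvature (connection C) (coord_field i) (coord_field j) (coord_field k) p $ l =
    G' j k l (axis i 1) - G' i k l (axis j 1)
    + (\<Sum>n\<in>UNIV. G p j k n * G p i n l - G p i k n * G p j n l)"
proof -
  have CC: "connection C (coord_field i) (coord_field j) = C i j" for i j
    by (rule ext) (rule connection_coord_field)
  have "((\<lambda>q. \<chi> l. G q i j l) has_derivative (\<lambda>v. \<chi> l. G' i j l v)) (at p)" for i j
    by (subst has_derivative_componentwise_within)
       (auto simp: Basis_vec_def inner_axis G)
  then have "(C i j has_derivative (\<lambda>v. \<chi> l. G' i j l v)) (at p)" for i j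
    by (rule has_derivative_transform_within_open[OF _ assms(1,2)]) (simp add: C)
  note fd = frechet_derivative_at[OF this, symmetric]
  have *: "connection C (coord_field i) (C j k) p $ l =
      G' j k l (axis i 1) + (\<Sum>n\<in>UNIV. G p j k n * G p i n l)" for i j k
  proof -
    have "(\<Sum>i'\<in>UNIV. \<Sum>n\<in>UNIV. (axis i 1 $ i' * C j k p $ n) *\<^sub>R C i' n p) =
        (\<Sum>i'\<in>UNIV. if i' = i then (\<Sum>n\<in>UNIV. (C j k p $ n) *\<^sub>R C i n p) else 0)"
      by (intro sum.cong refl) (auto simp: axis_def)
    then show ?thesis
      by (simp add: connection_def fd coord_field_def C[OF assms(2)])
  qed
  have "lie_bracket (coord_field i) (coord_field j) p = 0"
    by (simp add: lie_bracket_def coord_field_def)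
  then have "connection C (lie_bracket (coord_field i) (coord_field j)) (coord_field k) p = 0"
    by (simp add: connection_def coord_field_def)
  then show ?thesis by (simp add: curvature_def CC * sum_subtractf)
qed

text \<open>With w = p$1 / s the probability of the branch x < y, this is the 2-form s^2 dw \<and>
  dx_2. Likewise \<open>curv14_34\<close> is s^2 dw \<and> dx_4, and \<open>curv24\<close> is dx_2
  \<and> dx_4.\<close>

definition curv12_23 :: "real^4 \<Rightarrow> 4 \<Rightarrow> 4 \<Rightarrow> real" where
  "curv12_23 p i j =
     (if (i, j) = (1, 2) then p$3 else if (i, j) = (2, 1) then - p$3
      else if (i, j) = (2, 3) then p$1 else if (i, j) = (3, 2) then - p$1 else 0)"

definition curv14_34 :: "real^4 \<Rightarrow> 4 \<Rightarrow> 4 \<Rightarrow> real" where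
  "curv14_34 p i j =
     (if (i, j) = (1, 4) then p$3 else if (i, j) = (4, 1) then - p$3
      else if (i, j) = (3, 4) then - p$1 else if (i, j) = (4, 3) then p$1 else 0)"

definition curv24 :: "4 \<Rightarrow> 4 \<Rightarrow> real" where
  "curv24 i j = (if (i, j) = (2, 4) then 1 else if (i, j) = (4, 2) then - 1 else 0)"

definition freund_curvature :: "real \<Rightarrow> real^4 \<Rightarrow> 4 \<Rightarrow> 4 \<Rightarrow> 4 \<Rightarrow> 4 \<Rightarrow> real" where
  "freund_curvature \<alpha> p i j k l = (\<alpha>\<^sup>2 - 1) / 4 *
    (curv12_23 p i j * curv12_23 p k l / (p$1 * (p$1 + p$3) ^ 3 * (p$2)\<^sup>2)
    + curv14_34 p i j * curv14_34 p k l / (p$3 * (p$1 + p$3) ^ 3 * (p$4)\<^sup>2)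
    + p$1 * p$3 * curv24 i j * curv24 k l / ((p$1 + p$3)\<^sup>2 * (p$2)\<^sup>2 * (p$4)\<^sup>2))"

lemma alpha_curvature_christoffel:
  assumes p: "p \<in> freund_manifold"
  shows "alpha_curvature \<alpha> p i j k l = fisher_diag p l *
    (christoffel_deriv ((1 - \<alpha>) / 2) p j k l (axis i 1)
     - christoffel_deriv ((1 - \<alpha>) / 2) p i k l (axis j 1)
     + (\<Sum>n\<in>UNIV. christoffel ((1 - \<alpha>) / 2) p j k n * christoffel ((1 - \<alpha>) / 2) p i n l
         - christoffel ((1 - \<alpha>) / 2) p i k n * christoffel ((1 - \<alpha>) / 2) p j n l))"
  unfolding alpha_curvature_def fisher_metric_coord_field[OF p] alpha_connection_def
  by (subst curvature_coord_fields[OF open_freund_manifold p])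
     (auto simp: alpha_christoffel_eq intro: has_derivative_christoffel[OF p])

lemma alpha_curvature_eq:
  assumes p: "p \<in> freund_manifold"
  shows "alpha_curvature \<alpha> p i j k l = freund_curvature \<alpha> p i j k l"
proof -
  define c where "c = (1 - \<alpha>) / 2"
  \<comment> \<open>In terms of \<open>c\<close> the common factor is c (c - 1), so all 256 cases
    below become rational identities in \<open>c\<close> and the coordinates.\<close>
  have \<alpha>: "(\<alpha>\<^sup>2 - 1) / 4 = c * (c - 1)"
    by (simp add: c_def field_simps power2_eq_square)
  note [simp] = freund_manifold_nonzero[OF p]
  show ?thesis
    unfolding alpha_curvature_christoffel[OF p] freund_curvature_def \<alpha> c_def[symmetric]
    using exhaust_4[of i] exhaust_4[of j] exhaust_4[of k] exhaust_4[of l]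
    by (elim disjE; simp add: sum_4 axis_def fisher_diag_def christoffel_def christoffel_deriv_def
          Let_def doubleton_eq_iff curv12_23_def curv14_34_def curv24_def)
       (simp_all add: divide_simps power2_eq_square power3_eq_cube, simp_all add: algebra_simps)
qed

section \<open>Listed components, symmetries and vanishing components\<close>

theorem proposition1p4:
  fixes \<alpha> a1 b1 a2 b2 :: real and p :: "real^4"
    and R :: "4 \<Rightarrow> 4 \<Rightarrow> 4 \<Rightarrow> 4 \<Rightarrow> real"
  assumes "p \<in> freund_manifold"
    and "a1 = p $ 1" "b1 = p $ 2" "a2 = p $ 3" "b2 = p $ 4"
    and "R = alpha_curvature \<alpha> p"
  shows "R 1 2 1 2 = (\<alpha>\<^sup>2 - 1) * a2\<^sup>2 / (4 * a1 * (a1 + a2) ^ 3 * b1\<^sup>2)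
    \<and> R 1 2 2 3 = (\<alpha>\<^sup>2 - 1) * a2 / (4 * (a1 + a2) ^ 3 * b1\<^sup>2)
    \<and> R 1 4 1 4 = (\<alpha>\<^sup>2 - 1) * a2 / (4 * (a1 + a2) ^ 3 * b2\<^sup>2)
    \<and> R 1 4 3 4 = - (\<alpha>\<^sup>2 - 1) * a1 / (4 * (a1 + a2) ^ 3 * b2\<^sup>2)
    \<and> R 2 3 2 3 = (\<alpha>\<^sup>2 - 1) * a1 / (4 * (a1 + a2) ^ 3 * b1\<^sup>2)
    \<and> R 2 4 2 4 = (\<alpha>\<^sup>2 - 1) * a1 * a2 / (4 * (a1 + a2)\<^sup>2 * b1\<^sup>2 * b2\<^sup>2)
    \<and> R 3 4 3 4 = (\<alpha>\<^sup>2 - 1) * a1\<^sup>2 / (4 * a2 * (a1 + a2) ^ 3 * b2\<^sup>2)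
    \<and> (\<forall>i j k l. R i j k l = - R j i k l \<and> R i j k l = - R i j l k \<and> R i j k l = R k l i j)
    \<and> (\<forall>i j k l. (i, j, k, l) \<notin> symmetry_closure
          {(1,2,1,2), (1,2,2,3), (1,4,1,4), (1,4,3,4), (2,3,2,3), (2,4,2,4), (3,4,3,4)}
        \<longrightarrow> R i j k l = 0)"
proof -
  have R: "R i j k l = freund_curvature \<alpha> p i j k l" for i j k l
    using assms(6) alpha_curvature_eq[OF assms(1)] by simp
  show ?thesis
  proof (intro conjI allI impI)
    note [simp] = freund_manifold_nonzero[OF assms(1)]
    note defs = assms(2-5) R freund_curvature_def curv12_23_def curv14_34_def curv24_def
    show "R 1 2 1 2 = (\<alpha>\<^sup>2 - 1) * a2\<^sup>2 / (4 * a1 * (a1 + a2) ^ 3 * b1\<^sup>2)"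
      "R 1 2 2 3 = (\<alpha>\<^sup>2 - 1) * a2 / (4 * (a1 + a2) ^ 3 * b1\<^sup>2)"
      "R 1 4 1 4 = (\<alpha>\<^sup>2 - 1) * a2 / (4 * (a1 + a2) ^ 3 * b2\<^sup>2)"
      "R 1 4 3 4 = - (\<alpha>\<^sup>2 - 1) * a1 / (4 * (a1 + a2) ^ 3 * b2\<^sup>2)"
      "R 2 3 2 3 = (\<alpha>\<^sup>2 - 1) * a1 / (4 * (a1 + a2) ^ 3 * b1\<^sup>2)"
      "R 2 4 2 4 = (\<alpha>\<^sup>2 - 1) * a1 * a2 / (4 * (a1 + a2)\<^sup>2 * b1\<^sup>2 * b2\<^sup>2)"
      "R 3 4 3 4 = (\<alpha>\<^sup>2 - 1) * a1\<^sup>2 / (4 * a2 * (a1 + a2) ^ 3 * b2\<^sup>2)"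
      by (simp_all add: defs power2_eq_square divide_simps)
         (simp_all add: algebra_simps)
    fix i j k l
    have "curv12_23 p i j = - curv12_23 p j i" "curv14_34 p i j = - curv14_34 p j i"
      "curv24 i j = - curv24 j i" for i j
      by (auto simp: curv12_23_def curv14_34_def curv24_def)
    note antisym = this
    show "R i j k l = - R j i k l"
      by (simp add: R freund_curvature_def antisym[of i j] algebra_simps)
    show "R i j k l = - R i j l k"
      by (simp add: R freund_curvature_def antisym[of k l] algebra_simps)
    show "R i j k l = R k l i j"
      by (simp add: R freund_curvature_def mult_ac)
  next
    fix i j k l
    let ?S = "{(1,2,1,2), (1,2,2,3), (1,4,1,4), (1,4,3,4), (2,3,2,3), (2,4,2,4), (3,4,3,4)}
      :: (4 \<times> 4 \<times> 4 \<times> 4) set"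
    assume notin: "(i, j, k, l) \<notin> symmetry_closure ?S"
    have base: "(i, j, k, l) \<in> symmetry_closure ?S" if "(i, j, k, l) \<in> ?S" for i j k l
      using that by (rule symmetry_closure.base)
    \<comment> \<open>The symmetries generate eight rearrangements of a quadruple; none of them can
      lie in \<open>?S\<close>, or closure would bring \<open>(i, j, k, l)\<close> back in.\<close>
    have "(i, j, k, l) \<notin> ?S" "(j, i, k, l) \<notin> ?S" "(i, j, l, k) \<notin> ?S" "(j, i, l, k) \<notin> ?S"
      "(k, l, i, j) \<notin> ?S" "(l, k, i, j) \<notin> ?S" "(k, l, j, i) \<notin> ?S" "(l, k, j, i) \<notin> ?S"
      using notin base symmetry_closure.swap_first symmetry_closure.swap_last symmetry_closure.swap_pairs
      by meson+
    then show "R i j k l = 0"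
      \<comment> \<open>A nonzero component needs both index pairs in the support of one 2-form,
        that is {12, 23}, {14, 34} or {24} up to order; up to the symmetries these are the elements
        of \<open>?S\<close>.\<close>
      using exhaust_4[of i] exhaust_4[of j] exhaust_4[of k] exhaust_4[of l]
      by (elim disjE; simp add: R freund_curvature_def curv12_23_def curv14_34_def curv24_def)
  qed
qed

end
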